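(* There exists a transcendental entire function $f:\mathbb{C}\to\mathbb{C}$ such that $f$ has a simply connected fast escaping Fatou component (that is, a simply connected component $U$ of the Fatou set $F(f)$ with $U\subset A(f)$), and $f$ has no multiply connected Fatou components.
   Context: For a transcendental entire function $f$, the Fatou set $F(f)$ is the set of $z\in\mathbb{C}$ such that the family of iterates $(f^n)_{n\in\mathbb{N}}$ is normal in a neighbourhood of $z$; a Fatou component is a connected component of $F(f)$, and it is multiply connected if it is not simply connected. Put $M(r)=M(r,f)=\max_{|z|=r}|f(z)|$ for $r>0$, and let $M^n(r)$ denote the $n$-th iterate of the function $r\mapsto M(r)$. The fast escaping set is $$A(f)=\{z : \text{there exists } \ell\in\mathbb{N} \text{ such that } |f^{n+\ell}(z)|\geq M^n(R) \text{ for all } n\in\mathbb{N}\},$$ where $R>0$ is any value such that $M(r)>r$ for all $r\geq R$ (the set does not depend on the choice of such an $R$). A Fatou component is called fast escaping if it is contained in $A(f)$. Here $\mathbb{N}=\{1,2,\ldots\}$. *)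

theory Defs
  imports "HOL-Complex_Analysis.Complex_Analysis"
begin

definition transcendental_entire :: "(complex \<Rightarrow> complex) \<Rightarrow> bool" where
  "transcendental_entire f \<longleftrightarrow> f holomorphic_on UNIV \<and> \<not> (\<exists>p. f = poly p)"

(* Normality in the sense of Montel: limits are taken in the Riemann sphere.  On a connected
   open set a locally uniform limit of holomorphic functions is either finite everywhere
   or identically infinity, hence the two alternatives. *)
definition normal_family_on :: "complex set \<Rightarrow> (complex \<Rightarrow> complex) set \<Rightarrow> bool" where
  "normal_family_on V \<F> \<longleftrightarrow>
     (\<forall>G :: nat \<Rightarrow> complex \<Rightarrow> complex. range G \<subseteq> \<F> \<longrightarrow>
        (\<exists>r :: nat \<Rightarrow> nat. strict_mono r \<and>
           ((\<exists>g. \<forall>K. compact K \<and> K \<subseteq> V \<longrightarrow> uniform_limit K (\<lambda>n. G (r n)) g sequentially) \<or>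
            (\<forall>K. compact K \<and> K \<subseteq> V \<longrightarrow>
               (\<forall>B :: real. \<forall>\<^sub>F n in sequentially. \<forall>z\<in>K. B \<le> norm (G (r n) z))))))"

definition fatou_set :: "(complex \<Rightarrow> complex) \<Rightarrow> complex set" where
  "fatou_set f = {z. \<exists>V. open V \<and> connected V \<and> z \<in> V \<and> normal_family_on V {f ^^ n |n. 1 \<le> n}}"

abbreviation fatou_components :: "(complex \<Rightarrow> complex) \<Rightarrow> complex set set" where
  "fatou_components f \<equiv> components (fatou_set f)"

definition multiply_connected :: "complex set \<Rightarrow> bool" where
  "multiply_connected U \<longleftrightarrow> connected U \<and> \<not> simply_connected U"

(* For continuous f and r \<ge> 0 the supremum is attained (max_modulus_attained below);
   only such arguments are relevant. *)
definition max_modulus :: "(complex \<Rightarrow> complex) \<Rightarrow> real \<Rightarrow> real" where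
  "max_modulus f r = (SUP z\<in>sphere 0 r. norm (f z))"

definition admissible_radius :: "(complex \<Rightarrow> complex) \<Rightarrow> real \<Rightarrow> bool" where
  "admissible_radius f R \<longleftrightarrow> 0 < R \<and> (\<forall>r\<ge>R. r < max_modulus f r)"

(* Independence of the choice of R is fast_escaping_set_eq below. *)
definition fast_escaping_set :: "(complex \<Rightarrow> complex) \<Rightarrow> complex set" where
  "fast_escaping_set f =
     {z. \<exists>R. admissible_radius f R \<and>
        (\<exists>l\<ge>1. \<forall>n\<ge>1. (max_modulus f ^^ n) R \<le> norm ((f ^^ (n + l)) z))}"

lemma max_modulus_attained:
  assumes "f holomorphic_on UNIV" "0 \<le> r"
  shows "\<exists>z. norm z = r \<and> norm (f z) = max_modulus f r"
    and "norm w = r \<Longrightarrow> norm (f w) \<le> max_modulus f r"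
proof -
  have cont: "continuous_on (sphere 0 r) (\<lambda>z. norm (f z))"
    using assms(1) holomorphic_on_imp_continuous_on holomorphic_on_subset
    by (intro continuous_on_norm) blast
  have ne: "sphere (0::complex) r \<noteq> {}"
    using assms(2) by simp
  obtain z where z: "z \<in> sphere 0 r" "\<forall>w\<in>sphere 0 r. norm (f w) \<le> norm (f z)"
    using continuous_attains_sup[OF compact_sphere ne cont] by blast
  have "max_modulus f r = norm (f z)"
    unfolding max_modulus_def using z ne by (intro cSup_eq_maximum) auto
  then show "\<exists>z. norm z = r \<and> norm (f z) = max_modulus f r"
    and "norm w = r \<Longrightarrow> norm (f w) \<le> max_modulus f r"
    using z by auto
qed

lemma max_modulus_bound:
  assumes f: "f holomorphic_on UNIV" and w: "norm w \<le> r"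
  shows "norm (f w) \<le> max_modulus f r"
proof (cases "norm w = r")
  case True
  then show ?thesis using max_modulus_attained(2)[OF f] by force
next
  case False
  then have r: "0 < r" using w norm_ge_zero[of w] by linarith
  show ?thesis
  proof (rule maximum_modulus_frontier[of f "cball 0 r"])
    show "f holomorphic_on interior (cball 0 r)"
      using f holomorphic_on_subset by blast
    show "continuous_on (closure (cball 0 r)) f"
      using f holomorphic_on_imp_continuous_on holomorphic_on_subset by blast
    show "norm (f z) \<le> max_modulus f r" if "z \<in> frontier (cball 0 r)" for z
      using that r max_modulus_attained(2)[OF f, of r z] by auto
  qed (use w in auto)
qed

lemma max_modulus_mono:
  assumes "f holomorphic_on UNIV" "0 \<le> r" "r \<le> s"
  shows "max_modulus f r \<le> max_modulus f s"
  using max_modulus_attained(1)[OF assms(1,2)] max_modulus_bound[OF assms(1)] assms(3)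
  by metis

lemma max_modulus_funpow_ge:
  assumes "admissible_radius f R"
  shows "R \<le> (max_modulus f ^^ n) R"
  using assms by (induction n) (force simp: admissible_radius_def)+

lemma max_modulus_funpow_mono:
  assumes f: "f holomorphic_on UNIV" and "0 < R" "R \<le> S" "admissible_radius f R"
  shows "(max_modulus f ^^ n) R \<le> (max_modulus f ^^ n) S"
proof (induction n)
  case (Suc n)
  then show ?case
    using max_modulus_mono[OF f _ Suc] max_modulus_funpow_ge[OF assms(4), of n] \<open>0 < R\<close>
    by simp
qed (use assms in simp)

lemma max_modulus_funpow_unbounded:
  assumes f: "f holomorphic_on UNIV" and R: "admissible_radius f R"
  shows "\<exists>m. S \<le> (max_modulus f ^^ m) R"
proof (rule ccontr)
  define a where "a n = (max_modulus f ^^ n) R" for n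
  assume "\<not> ?thesis"
  then have bdd: "bdd_above (range a)"
    unfolding a_def by (auto intro!: bdd_aboveI[of _ S] simp: not_le less_imp_le)
  define L where "L = (SUP n. a n)"
  have le: "a n \<le> L" for n
    unfolding L_def using bdd by (intro cSUP_upper) auto
  have "R \<le> L" using le[of 0] by (simp add: a_def)
  then have L: "0 < L" "L < max_modulus f L"
    using R by (auto simp: admissible_radius_def)
  obtain z where z: "norm z = L" "norm (f z) = max_modulus f L"
    using max_modulus_attained(1)[OF f less_imp_le[OF L(1)]] by blast
  have "isCont f z"
    using f by (metis UNIV_I open_UNIV continuous_on_eq_continuous_at holomorphic_on_imp_continuous_on)
  then have "\<forall>\<^sub>F w in at z. L < norm (f w)"
    unfolding isCont_def using L z by (intro order_tendstoD(1)[OF tendsto_norm]) auto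
  then obtain d where d: "0 < d" "\<And>w. w \<noteq> z \<Longrightarrow> dist w z < d \<Longrightarrow> L < norm (f w)"
    unfolding eventually_at by blast
  define e where "e = min (d / 2) (L / 2)"
  have e: "0 < e" "e < d" "e < L" using d L by (auto simp: e_def)
  obtain n where n: "L - e < a n"
    using less_cSUP_iff[of UNIV a "L - e"] bdd e unfolding L_def by auto
  define w where "w = of_real ((L - e) / L) * z"
  have "w - z = of_real (- e / L) * z"
    using L by (simp add: w_def field_simps)
  then have "dist w z = e"
    using L e z by (simp add: dist_norm norm_mult norm_divide)
  then have "L < norm (f w)"
    using d e by (metis dist_self less_irrefl)
  moreover have "norm w = L - e"
    using L e z by (simp add: w_def norm_mult norm_divide del: of_real_diff)
  then have "norm (f w) \<le> max_modulus f (a n)"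
    using n by (intro max_modulus_bound[OF f]) auto
  ultimately have "L < a (Suc n)" by (simp add: a_def)
  then show False using le[of "Suc n"] by simp
qed

lemma fast_escaping_set_eq:
  assumes f: "f holomorphic_on UNIV" and R: "admissible_radius f R"
  shows "fast_escaping_set f =
    {z. \<exists>l\<ge>1. \<forall>n\<ge>1. (max_modulus f ^^ n) R \<le> norm ((f ^^ (n + l)) z)}"
proof (intro set_eqI iffI)
  fix z assume "z \<in> fast_escaping_set f"
  then obtain S l where S: "admissible_radius f S" "l \<ge> 1"
    "\<And>n. n \<ge> 1 \<Longrightarrow> (max_modulus f ^^ n) S \<le> norm ((f ^^ (n + l)) z)"
    unfolding fast_escaping_set_def by blast
  obtain m where m: "R \<le> (max_modulus f ^^ m) S"
    using max_modulus_funpow_unbounded[OF f S(1)] by blast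
  have "(max_modulus f ^^ n) R \<le> norm ((f ^^ (n + (m + l))) z)" if "n \<ge> 1" for n
  proof -
    have "(max_modulus f ^^ n) R \<le> (max_modulus f ^^ n) ((max_modulus f ^^ m) S)"
      using R m by (intro max_modulus_funpow_mono[OF f]) (auto simp: admissible_radius_def)
    also have "\<dots> = (max_modulus f ^^ (n + m)) S"
      by (simp add: funpow_add)
    also have "\<dots> \<le> norm ((f ^^ (n + (m + l))) z)"
      using S(3)[of "n + m"] that by (simp add: add.assoc)
    finally show ?thesis .
  qed
  then show "z \<in> {z. \<exists>l\<ge>1. \<forall>n\<ge>1. (max_modulus f ^^ n) R \<le> norm ((f ^^ (n + l)) z)}"
    using S(2) by (intro CollectI exI[of _ "m + l"]) auto
qed (use R in \<open>auto simp: fast_escaping_set_def\<close>)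

end

theory Submission
  imports Defs "HOL-Computational_Algebra.Fundamental_Theorem_Algebra"
begin

text \<open>
  Take an entire function f that maps the half-plane Re z \<le> 1 into the disc of radius 1/2 and,
  for a rapidly growing sequence of reals a n, maps the unit disc around a n to within 1/2 of
  a (n + 1), where a (n + 1) is at least (n + 1) times the maximum of |f| on |z| \<le> a n / 2. It is
  a sum of corrections (a (n + 1) - S n) * phi n, where S n is the sum of the previous
  terms and phi n is entire, close to 1 on the disc around a n and close to 0 on
  Re z \<le> a n / 2; since S n is bounded on Re z \<le> 1, no quantitative control beyond smallness of
  phi n is needed, and a (n + 1) is at our disposal.

  If a Fatou component U has an orbit that enters the half-plane, then the iterates are locally
  bounded on U, and by the maximum principle they are bounded on every bounded domain C whose
  frontier lies in U. Otherwise Re f^n > 1 on U for all n, and this passes to C as Re f^n \<ge> 1. In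
  both cases Montel's theorem puts C into the Fatou set, so U is simply connected.

  The component of the first disc is of the second kind, so Harnack's inequality for the positive
  harmonic functions Re f^n shows that all its orbits grow like a n up to constant factors,
  and those are absorbed by the factor n + 1 above.
\<close>

subsection \<open>Normal families of iterates\<close>

lemma normal_family_on_bounded:
  assumes "open V" and hol: "\<And>F. F \<in> \<F> \<Longrightarrow> F holomorphic_on V"
    and bdd: "\<And>F z. F \<in> \<F> \<Longrightarrow> z \<in> V \<Longrightarrow> norm (F z) \<le> B"
  shows "normal_family_on V \<F>"
  unfolding normal_family_on_def
proof (intro allI impI)
  fix G :: "nat \<Rightarrow> complex \<Rightarrow> complex" assume G: "range G \<subseteq> \<F>"
  obtain g r where r: "strict_mono (r :: nat \<Rightarrow> nat)"
    and lim: "\<And>K. compact K \<Longrightarrow> K \<subseteq> V \<Longrightarrow> uniform_limit K (G \<circ> r) g sequentially"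
    by (rule Montel[OF \<open>open V\<close> hol _ G]) (use bdd in blast)+
  show "\<exists>r. strict_mono r \<and>
      ((\<exists>g. \<forall>K. compact K \<and> K \<subseteq> V \<longrightarrow> uniform_limit K (\<lambda>n. G (r n)) g sequentially) \<or>
       (\<forall>K. compact K \<and> K \<subseteq> V \<longrightarrow> (\<forall>B. \<forall>\<^sub>F n in sequentially. \<forall>z\<in>K. B \<le> norm (G (r n) z))))"
    using r lim unfolding o_def by blast
qed

text \<open>The reciprocals are bounded by 1, so Montel applies to them. By Hurwitz their limit
  \<open>q\<close> either vanishes identically, and then the original functions tend to infinity, or
  has no zeros, and then they tend to 1/\<open>q\<close>.\<close>

lemma normal_family_on_norm_ge_1:
  assumes V: "open V" "connected V" and hol: "\<And>F. F \<in> \<F> \<Longrightarrow> F holomorphic_on V"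
    and ge: "\<And>F z. F \<in> \<F> \<Longrightarrow> z \<in> V \<Longrightarrow> 1 \<le> norm (F z)"
  shows "normal_family_on V \<F>"
  unfolding normal_family_on_def
proof (intro allI impI)
  fix G :: "nat \<Rightarrow> complex \<Rightarrow> complex" assume G: "range G \<subseteq> \<F>"
  define h where "h n z = inverse (G n z)" for n z
  have nz: "G n z \<noteq> 0" and ge': "1 \<le> norm (G n z)" if "z \<in> V" for n z
    using ge[of "G n" z] G that by fastforce+
  have holG: "G n holomorphic_on V" for n using G hol by blast
  have hol_h: "h n holomorphic_on V" for n
    unfolding h_def using holG nz by (intro holomorphic_intros) auto
  have h_le: "norm (h n z) \<le> 1" if "z \<in> V" for n z
    using ge'[OF that, of n] by (simp add: h_def norm_inverse inverse_le_1_iff)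
  obtain q r where holq: "q holomorphic_on V" and r: "strict_mono (r :: nat \<Rightarrow> nat)"
    and lim: "\<And>K. compact K \<Longrightarrow> K \<subseteq> V \<Longrightarrow> uniform_limit K (h \<circ> r) q sequentially"
  proof (rule Montel[OF \<open>open V\<close>, of "range h" h])
    show "\<exists>B. \<forall>h\<in>range h. \<forall>z\<in>K. norm (h z) \<le> B" if "K \<subseteq> V" for K
      using h_le that by blast
  qed (use hol_h in auto)
  have "(\<exists>g. \<forall>K. compact K \<and> K \<subseteq> V \<longrightarrow> uniform_limit K (\<lambda>n. G (r n)) g sequentially) \<or>
       (\<forall>K. compact K \<and> K \<subseteq> V \<longrightarrow> (\<forall>B. \<forall>\<^sub>F n in sequentially. \<forall>z\<in>K. B \<le> norm (G (r n) z)))"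
  proof (cases "\<forall>z\<in>V. q z = 0")
    case True
    have "\<forall>\<^sub>F n in sequentially. \<forall>z\<in>K. B \<le> norm (G (r n) z)" if K: "compact K" "K \<subseteq> V" for K B
    proof -
      have "\<forall>\<^sub>F n in sequentially. \<forall>z\<in>K. dist ((h \<circ> r) n z) (q z) < inverse (\<bar>B\<bar> + 1)"
        by (rule uniform_limitD[OF lim[OF K]]) auto
      then show ?thesis
      proof (rule eventually_mono, intro ballI)
        fix n z assume *: "\<forall>z\<in>K. dist ((h \<circ> r) n z) (q z) < inverse (\<bar>B\<bar> + 1)" and z: "z \<in> K"
        then have "inverse (norm (G (r n) z)) < inverse (\<bar>B\<bar> + 1)"
          using True K z by (auto simp: h_def simp flip: norm_inverse dest!: bspec)
        then have "\<bar>B\<bar> + 1 < norm (G (r n) z)"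
          using ge'[of z "r n"] z K by (subst (asm) inverse_less_iff_less) auto
        then show "B \<le> norm (G (r n) z)" by linarith
      qed
    qed
    then show ?thesis by blast
  next
    case False
    have q_nz: "q z \<noteq> 0" if "z \<in> V" for z
    proof (cases "q constant_on V")
      case True
      then show ?thesis using False that unfolding constant_on_def by metis
    next
      case nonconst: False
      show ?thesis
      proof (rule Hurwitz_no_zeros[OF V _ holq _ nonconst _ that])
        show "uniform_limit K (h \<circ> r) q sequentially" if "compact K" "K \<subseteq> V" for K
          using lim that .
        show "(h \<circ> r) n holomorphic_on V" for n using hol_h by simp
        show "(h \<circ> r) n z \<noteq> 0" if "z \<in> V" for n z using nz[OF that] by (simp add: h_def)
      qed
    qed
    have "uniform_limit K (\<lambda>n. G (r n)) (inverse \<circ> q) sequentially"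
      if K: "compact K" "K \<subseteq> V" for K
    proof (cases "K = {}")
      case False
      have "continuous_on K (\<lambda>z. norm (q z))"
        using holq K holomorphic_on_imp_continuous_on continuous_on_subset
        by (intro continuous_on_norm) blast
      \<comment> \<open>The minimum of the modulus of \<open>q\<close> on \<open>K\<close> is
        positive, which keeps the inversion uniform.\<close>
      then obtain z0 where z0: "z0 \<in> K" "\<And>z. z \<in> K \<Longrightarrow> norm (q z0) \<le> norm (q z)"
        using continuous_attains_inf[OF K(1) False] by blast
      have "uniform_limit K (\<lambda>n z. inverse ((h \<circ> r) n z)) (inverse \<circ> q) sequentially"
        by (rule uniform_lim_inverse[OF lim[OF K], of "norm (q z0)"]) (use z0 q_nz K in auto)
      then show ?thesis by (simp add: h_def)
    qed auto
    then show ?thesis by blast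
  qed
  with r show "\<exists>r. strict_mono r \<and>
      ((\<exists>g. \<forall>K. compact K \<and> K \<subseteq> V \<longrightarrow> uniform_limit K (\<lambda>n. G (r n)) g sequentially) \<or>
       (\<forall>K. compact K \<and> K \<subseteq> V \<longrightarrow> (\<forall>B. \<forall>\<^sub>F n in sequentially. \<forall>z\<in>K. B \<le> norm (G (r n) z))))"
    by blast
qed

section \<open>Bounded orbits in a Fatou component\<close>

lemma holomorphic_on_funpow:
  assumes "f holomorphic_on UNIV"
  shows "(f ^^ n) holomorphic_on A"
proof (induction n)
  case 0
  show ?case by (simp add: id_def holomorphic_on_ident)
next
  case (Suc n)
  then show ?case
    using holomorphic_on_compose_gen[OF _ assms] by (simp add: o_def)
qed

text \<open>The bounded orbit of \<open>z\<close> rules out the limit infinity, so every sequence of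
  iterates has a subsequence with a finite limit, uniform on \<open>K\<close>. This is incompatible
  with values on \<open>K\<close> growing without bound along the sequence.\<close>

lemma normal_bounded_orbit_imp_locally_bounded:
  assumes f: "f holomorphic_on UNIV" and normal: "normal_family_on V {f ^^ n |n. 1 \<le> n}"
    and z: "z \<in> V" "\<And>n. 1 \<le> n \<Longrightarrow> norm ((f ^^ n) z) \<le> B"
    and K: "compact K" "K \<subseteq> V"
  shows "\<exists>M. \<forall>n\<ge>1. \<forall>v\<in>K. norm ((f ^^ n) v) \<le> M"
proof (rule ccontr)
  assume "\<not> ?thesis"
  then have "\<forall>j::nat. \<exists>n v. 1 \<le> n \<and> v \<in> K \<and> real j < norm ((f ^^ n) v)"
    by (meson not_le)
  then obtain N v where Nv: "\<And>j::nat. 1 \<le> N j" "\<And>j. v j \<in> K" "\<And>j. real j < norm ((f ^^ N j) (v j))"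
    by metis
  have "range (\<lambda>j. f ^^ N j) \<subseteq> {f ^^ n |n. 1 \<le> n}" using Nv(1) by auto
  then obtain r :: "nat \<Rightarrow> nat" where r: "strict_mono r" and
    alt: "(\<exists>g. \<forall>K. compact K \<and> K \<subseteq> V \<longrightarrow> uniform_limit K (\<lambda>j. f ^^ N (r j)) g sequentially) \<or>
     (\<forall>K. compact K \<and> K \<subseteq> V \<longrightarrow> (\<forall>B. \<forall>\<^sub>F j in sequentially. \<forall>z\<in>K. B \<le> norm ((f ^^ N (r j)) z)))"
    using normal unfolding normal_family_on_def by meson
  from alt show False
  proof
    assume "\<exists>g. \<forall>K. compact K \<and> K \<subseteq> V \<longrightarrow> uniform_limit K (\<lambda>j. f ^^ N (r j)) g sequentially"
    then obtain g where "uniform_limit K (\<lambda>j. f ^^ N (r j)) g sequentially" using K by blast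
    then have "\<forall>\<^sub>F j in sequentially. \<forall>x\<in>K. dist ((f ^^ N (r j)) x) (g x) < 1"
      by (rule uniform_limitD) simp
    then obtain J where J: "\<And>j x. J \<le> j \<Longrightarrow> x \<in> K \<Longrightarrow> dist ((f ^^ N (r j)) x) (g x) < 1"
      unfolding eventually_sequentially by blast
    \<comment> \<open>The bound comes from the single continuous iterate at index \<open>J\<close>:
      through \<open>g\<close>, every later member of the subsequence is within 2 of it on
      \<open>K\<close>.\<close>
    have "continuous_on K (f ^^ N (r J))"
      using holomorphic_on_funpow[OF f] holomorphic_on_imp_continuous_on by blast
    then have "bounded ((f ^^ N (r J)) ` K)"
      using K(1) compact_continuous_image compact_imp_bounded by blast
    then obtain M where M: "\<And>x. x \<in> K \<Longrightarrow> norm ((f ^^ N (r J)) x) \<le> M"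
      unfolding bounded_iff by blast
    obtain j :: nat where j: "M + 2 \<le> real j" "J \<le> j"
      using real_arch_simple[of "max (M + 2) (real J)"] by auto
    let ?x = "v (r j)" and ?F = "f ^^ N (r j)" and ?E = "f ^^ N (r J)"
    have "norm (?F ?x) \<le> norm (?E ?x) + dist (?F ?x) (g ?x) + dist (?E ?x) (g ?x)"
      by norm
    moreover have "norm (?E ?x) + dist (?F ?x) (g ?x) + dist (?E ?x) (g ?x) < M + 2"
      using M[OF Nv(2)[of "r j"]] J[OF j(2) Nv(2)[of "r j"]] J[OF order_refl Nv(2)[of "r j"]] by linarith
    moreover have "M + 2 \<le> real (r j)"
      using j(1) seq_suble[OF r, of j] by linarith
    ultimately show False using Nv(3)[of "r j"] by linarith
  next
    assume *: "\<forall>K. compact K \<and> K \<subseteq> V \<longrightarrow> (\<forall>B. \<forall>\<^sub>F j in sequentially. \<forall>z\<in>K. B \<le> norm ((f ^^ N (r j)) z))"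
    have "\<forall>\<^sub>F j in sequentially. \<forall>x\<in>{z}. B + 1 \<le> norm ((f ^^ N (r j)) x)"
      by (rule *[rule_format]) (use z(1) in simp)
    from eventually_happens'[OF sequentially_bot this]
    obtain j where "B + 1 \<le> norm ((f ^^ N (r j)) z)" by auto
    then show False using z(2)[OF Nv(1)[of "r j"]] by linarith
  qed
qed

lemma open_fatou_set: "open (fatou_set f)"
  unfolding open_subopen[of "fatou_set f"] by (auto simp: fatou_set_def)

lemma normal_imp_subset_fatou_set:
  assumes "open V" "connected V" "normal_family_on V {f ^^ n |n. 1 \<le> n}"
  shows "V \<subseteq> fatou_set f"
proof
  fix z assume "z \<in> V"
  with assms have "open V \<and> connected V \<and> z \<in> V \<and> normal_family_on V {f ^^ n |n. 1 \<le> n}"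
    by (intro conjI)
  then show "z \<in> fatou_set f"
    unfolding fatou_set_def mem_Collect_eq by (rule exI)
qed

text \<open>Boundedness of orbits does not change within a neighbourhood of normality, so by
  connectedness it spreads from \<open>z\<close> to all of \<open>U\<close>. Normality near
  \<open>w\<close> then turns it into a bound uniform in the point and the iterate.\<close>

lemma fatou_component_bounded_orbits:
  assumes f: "f holomorphic_on UNIV" and U: "U \<in> fatou_components f"
    and z: "z \<in> U" "\<And>n. 1 \<le> n \<Longrightarrow> norm ((f ^^ n) z) \<le> B" and w: "w \<in> U"
  shows "\<exists>r>0. \<exists>M. \<forall>n\<ge>1. \<forall>v\<in>ball w r. norm ((f ^^ n) v) \<le> M"
proof -
  define bo where "bo x \<longleftrightarrow> (\<exists>B. \<forall>n\<ge>1. norm ((f ^^ n) x) \<le> B)" for x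
  have loc: "\<exists>V. open V \<and> x \<in> V \<and> normal_family_on V {f ^^ n |n. 1 \<le> n}" if "x \<in> U" for x
    using that in_components_subset[OF U] by (auto simp: fatou_set_def)
  have trans: "bo y" if "normal_family_on V {f ^^ n |n. 1 \<le> n}" "x \<in> V" "y \<in> V" "bo x" for V x y
    using normal_bounded_orbit_imp_locally_bounded[OF f that(1,2), of _ "{y}"] that(3,4)
    unfolding bo_def by auto
  have "bo z \<longleftrightarrow> bo w"
  proof (rule connected_equivalence_relation[of U _ _ "\<lambda>x y. bo x \<longleftrightarrow> bo y"])
    show "\<exists>T. openin (top_of_set U) T \<and> x \<in> T \<and> (\<forall>y\<in>T. bo x \<longleftrightarrow> bo y)" if x: "x \<in> U" for x
    proof -
      obtain V where V: "open V" "x \<in> V" "normal_family_on V {f ^^ n |n. 1 \<le> n}"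
        using loc[OF x] by blast
      then have "openin (top_of_set U) (U \<inter> V)" "x \<in> U \<inter> V" "\<forall>y\<in>U \<inter> V. bo x \<longleftrightarrow> bo y"
        using trans[OF V(3)] x by auto
      then show ?thesis by blast
    qed
  qed (use U in_components_connected z(1) w in auto)
  then obtain B' where B': "\<And>n. 1 \<le> n \<Longrightarrow> norm ((f ^^ n) w) \<le> B'"
    using z(2) unfolding bo_def by blast
  obtain V where V: "open V" "w \<in> V" "normal_family_on V {f ^^ n |n. 1 \<le> n}"
    using loc[OF w] by blast
  then obtain r where r: "r > 0" "cball w r \<subseteq> V"
    using open_contains_cball by blast
  obtain M where "\<forall>n\<ge>1. \<forall>v\<in>cball w r. norm ((f ^^ n) v) \<le> M"
    using normal_bounded_orbit_imp_locally_bounded[OF f V(3,2) B' compact_cball r(2)] by blast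
  then show ?thesis using r(1) by (meson ball_subset_cball subsetD)
qed

lemma fatou_component_bounded_orbits_compact:
  assumes f: "f holomorphic_on UNIV" and U: "U \<in> fatou_components f"
    and z: "z \<in> U" "\<And>n. 1 \<le> n \<Longrightarrow> norm ((f ^^ n) z) \<le> B" and K: "compact K" "K \<subseteq> U"
  shows "\<exists>M. \<forall>n\<ge>1. \<forall>v\<in>K. norm ((f ^^ n) v) \<le> M"
proof -
  obtain r M where rM: "\<And>w. w \<in> U \<Longrightarrow> r w > 0"
    "\<And>w n v. w \<in> U \<Longrightarrow> 1 \<le> n \<Longrightarrow> v \<in> ball w (r w) \<Longrightarrow> norm ((f ^^ n) v) \<le> (M w :: real)"
    using fatou_component_bounded_orbits[OF f U z] by metis
  have "K \<subseteq> (\<Union>w\<in>K. ball w (r w))" using rM(1) K(2) by force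
  then obtain D where D: "D \<subseteq> K" "finite D" "K \<subseteq> (\<Union>w\<in>D. ball w (r w))"
    using compactE_image[OF K(1), of K "\<lambda>w. ball w (r w)"] by blast
  have "norm ((f ^^ n) v) \<le> (\<Sum>w\<in>D. \<bar>M w\<bar>)" if n: "1 \<le> n" and v: "v \<in> K" for n v
  proof -
    obtain w where w: "w \<in> D" "v \<in> ball w (r w)" using D(3) v by blast
    then have "norm ((f ^^ n) v) \<le> \<bar>M w\<bar>"
      using rM(2)[of w n v] D(1) K(2) n by fastforce
    also have "\<dots> \<le> (\<Sum>w\<in>D. \<bar>M w\<bar>)"
      using D(2) w(1) by (intro member_le_sum) auto
    finally show ?thesis .
  qed
  then show ?thesis by blast
qed

section \<open>Maximum principle, simple connectivity and Harnack's inequality\<close>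

text \<open>Maximum principle for the function exp (- F), of modulus exp (- Re F).\<close>

lemma Re_ge_on_frontier:
  assumes "F holomorphic_on UNIV" "bounded C" "\<And>z. z \<in> frontier C \<Longrightarrow> c \<le> Re (F z)" "z \<in> C"
  shows "c \<le> Re (F z)"
proof -
  have "norm (exp (- F z)) \<le> exp (- c)"
  proof (rule maximum_modulus_frontier[of "\<lambda>z. exp (- F z)" C])
    have hol: "(\<lambda>z. exp (- F z)) holomorphic_on A" for A
      using holomorphic_on_subset[OF assms(1)] by (intro holomorphic_intros) auto
    then show "(\<lambda>z. exp (- F z)) holomorphic_on interior C" .
    show "continuous_on (closure C) (\<lambda>z. exp (- F z))"
      using hol holomorphic_on_imp_continuous_on by blast
  qed (use assms in auto)
  then show ?thesis by simp
qed

text \<open>If a loop in \<open>S\<close> winds around a point outside \<open>S\<close>, that point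
  lies in a bounded complementary component \<open>C\<close> of the loop, with frontier on the loop.
  Once \<open>C\<close> lies in \<open>F\<close>, its closure is a connected subset of
  \<open>F\<close> meeting \<open>S\<close>, hence lies in \<open>S\<close>, a
  contradiction.\<close>

lemma simply_connected_if_fills_frontier:
  fixes S :: "complex set"
  assumes "open F" "S \<in> components F"
    and fill: "\<And>C. open C \<Longrightarrow> connected C \<Longrightarrow> bounded C \<Longrightarrow> frontier C \<subseteq> S \<Longrightarrow> C \<subseteq> F"
  shows "simply_connected S"
proof -
  have "open S" using assms open_components by blast
  moreover have "winding_number g z = 0"
    if g: "path g" "path_image g \<subseteq> S" "pathfinish g = pathstart g" and z: "z \<notin> S" for g z
  proof (rule ccontr)
    assume nz: "winding_number g z \<noteq> 0"
    define C where "C = connected_component_set (- path_image g) z"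
    have zC: "z \<in> C" using z g(2) by (auto simp: C_def)
    have cl: "closed (path_image g)" using g(1) closed_path_image by blast
    then have opC: "open C" by (simp add: C_def open_connected_component open_Compl)
    have bdd: "bounded C"
      using nz winding_number_zero_in_outside[OF g(1,3), of z] by (auto simp: outside C_def)
    have fr: "frontier C \<subseteq> path_image g"
      unfolding C_def using frontier_of_connected_component_subset[of "- path_image g" z]
        cl frontier_subset_eq[of "path_image g"] by (auto simp: frontier_complement)
    have CF: "C \<subseteq> F"
      using fr g(2) by (intro fill opC bdd) (auto simp: C_def)
    \<comment> \<open>A nonempty bounded set has frontier points. They lie on the loop, so the
      closure of \<open>C\<close> meets \<open>S\<close>.\<close>
    have "C \<noteq> UNIV" using bdd not_bounded_UNIV by auto
    then have fr_ne: "frontier C \<noteq> {}"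
      using zC frontier_eq_empty by blast
    have clC: "closure C = C \<union> frontier C" by (simp add: closure_Un_frontier)
    have "closure C \<subseteq> S"
    proof (rule components_maximal[OF assms(2)])
      show "connected (closure C)" by (simp add: C_def connected_imp_connected_closure)
      show "closure C \<subseteq> F" "S \<inter> closure C \<noteq> {}"
        using clC CF fr fr_ne g(2) in_components_subset[OF assms(2)] by auto
    qed
    then show False using zC z clC by blast
  qed
  ultimately show ?thesis
    using in_components_connected[OF assms(2)] by (auto simp: simply_connected_eq_winding_number_zero)
qed

text \<open>The Schwarz lemma bounds the Cayley transform of \<open>F z\<close> by t = 1/2;
  comparing real parts then gives the Harnack constant (1 + t) / (1 - t) = 3.\<close>

lemma Harnack_half_ball:
  assumes hol: "F holomorphic_on ball w r" and pos: "\<And>z. z \<in> ball w r \<Longrightarrow> 0 < Re (F z)"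
    and z: "dist w z \<le> r / 2" and r: "0 < r"
  shows "Re (F w) \<le> 3 * Re (F z)"
proof -
  let ?a = "F w"
  have a: "0 < Re ?a" using pos r by simp
  \<comment> \<open>Schwarz lemma after a Cayley transform of the right half-plane that sends F w to 0.\<close>
  define \<phi> where "\<phi> \<zeta> = (F (w + of_real r * \<zeta>) - ?a) / (F (w + of_real r * \<zeta>) + cnj ?a)" for \<zeta>
  have mem: "w + of_real r * \<zeta> \<in> ball w r" if "norm \<zeta> < 1" for \<zeta>
    using that r by (simp add: dist_norm norm_mult)
  have nz: "F (w + of_real r * \<zeta>) + cnj ?a \<noteq> 0" if "norm \<zeta> < 1" for \<zeta>
    using pos[OF mem[OF that]] a by (auto simp: complex_eq_iff)
  have "(\<lambda>\<zeta>. F (w + of_real r * \<zeta>)) holomorphic_on ball 0 1"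
    by (rule holomorphic_on_compose_gen[OF _ hol, unfolded o_def])
      (use mem in \<open>auto intro!: holomorphic_intros\<close>)
  then have hol\<phi>: "\<phi> holomorphic_on ball 0 1"
    unfolding \<phi>_def using nz by (intro holomorphic_intros) auto
  \<comment> \<open>The mirror image of \<open>?a\<close> in the imaginary axis is
    \<open>- cnj ?a\<close>, so points of the right half-plane are closer to
    \<open>?a\<close>.\<close>
  have less: "norm (b - ?a) < norm (b + cnj ?a)" if "0 < Re b" for b
  proof -
    have "(norm (b + cnj ?a))\<^sup>2 - (norm (b - ?a))\<^sup>2 = 4 * Re b * Re ?a"
      by (simp only: cmod_power2) (simp add: power2_eq_square algebra_simps)
    moreover have "0 < 4 * Re b * Re ?a" using a that by simp
    ultimately show ?thesis by (intro power2_less_imp_less[of _ "norm (b + cnj ?a)"]) auto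
  qed
  have "norm (\<phi> \<zeta>) < 1" if "norm \<zeta> < 1" for \<zeta>
    using less[OF pos[OF mem[OF that]]] nz[OF that]
    by (simp add: \<phi>_def norm_divide)
  then have schwarz: "norm (\<phi> \<zeta>) \<le> norm \<zeta>" if "norm \<zeta> < 1" for \<zeta>
    using Schwarz_Lemma(1)[OF hol\<phi> _ _ that] by (auto simp: \<phi>_def)
  define \<zeta> where "\<zeta> = (z - w) / of_real r"
  have \<zeta>: "norm \<zeta> \<le> 1 / 2" "w + of_real r * \<zeta> = z"
    using z r by (auto simp: \<zeta>_def norm_divide dist_norm norm_minus_commute field_simps)
  let ?b = "F z"
  have zb: "z \<in> ball w r" using z r by simp
  have "norm (\<phi> \<zeta>) \<le> 1 / 2"
    using schwarz[of \<zeta>] \<zeta>(1) by linarith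
  then have "norm (?b - ?a) / norm (?b + cnj ?a) \<le> 1 / 2"
    unfolding \<phi>_def \<zeta>(2) norm_divide .
  moreover have "0 < norm (?b + cnj ?a)" using less[OF pos[OF zb]] by (smt (verit) norm_ge_zero)
  ultimately have "2 * norm (?b - ?a) \<le> norm (?b + cnj ?a)"
    by (simp add: field_simps)
  then have "(2 * norm (?b - ?a))\<^sup>2 \<le> (norm (?b + cnj ?a))\<^sup>2"
    by (intro power_mono) auto
  then have "4 * (Re ?b - Re ?a)\<^sup>2 + 3 * (Im ?b - Im ?a)\<^sup>2 \<le> (Re ?b + Re ?a)\<^sup>2"
    by (simp add: power_mult_distrib cmod_power2)
  then have "4 * (Re ?b - Re ?a)\<^sup>2 \<le> (Re ?b + Re ?a)\<^sup>2"
    by (smt (verit) zero_le_power2)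
  then have "(2 * (Re ?a - Re ?b))\<^sup>2 \<le> (Re ?b + Re ?a)\<^sup>2"
    by (simp add: power2_eq_square algebra_simps)
  then have "2 * (Re ?a - Re ?b) \<le> Re ?b + Re ?a"
    by (rule power2_le_imp_le) (use a pos[OF zb] in auto)
  then show ?thesis by simp
qed

subsection \<open>Entire functions with an absorbing half-plane\<close>

locale absorbing_half_plane =
  fixes f :: "complex \<Rightarrow> complex"
  assumes entire: "f holomorphic_on UNIV"
    and small: "\<And>z. Re z \<le> 1 \<Longrightarrow> norm (f z) \<le> 1 / 2"
begin

text \<open>The disc of radius 1/2 lies in the half-plane, so \<open>small\<close> applies again at
  every later iterate.\<close>

lemma orbit_absorbed:
  assumes "Re ((f ^^ n) z) \<le> 1" "n < m"
  shows "norm ((f ^^ m) z) \<le> 1 / 2"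
proof -
  have "norm ((f ^^ (n + Suc k)) z) \<le> 1 / 2" for k
  proof (induction k)
    case 0
    then show ?case using small assms(1) by simp
  next
    case (Suc k)
    then have "Re ((f ^^ (n + Suc k)) z) \<le> 1"
      using complex_Re_le_cmod[of "(f ^^ (n + Suc k)) z"] by linarith
    from small[OF this] show ?case by simp
  qed
  from this[of "m - Suc n"] assms(2) show ?thesis by simp
qed

lemma absorbed_orbit_bounded:
  assumes "Re ((f ^^ n) z) \<le> 1"
  shows "\<exists>B. \<forall>m\<ge>1. norm ((f ^^ m) z) \<le> B"
\<comment> \<open>The sum covers the iterates up to the entry into the half-plane, and 1/2 covers
  all later ones.\<close>
proof (intro exI[of _ "1 / 2 + (\<Sum>m\<le>n. norm ((f ^^ m) z))"] allI impI)
  fix m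
  show "norm ((f ^^ m) z) \<le> 1 / 2 + (\<Sum>m\<le>n. norm ((f ^^ m) z))"
  proof (cases "n < m")
    case True
    have "0 \<le> (\<Sum>m\<le>n. norm ((f ^^ m) z))" by (intro sum_nonneg) auto
    then show ?thesis using orbit_absorbed[OF assms True] by linarith
  next
    case False
    then have "norm ((f ^^ m) z) \<le> (\<Sum>m\<le>n. norm ((f ^^ m) z))"
      by (intro member_le_sum) auto
    then show ?thesis by linarith
  qed
qed

lemma normal_if_Re_ge_1:
  assumes "open V" "connected V" "\<And>n z. 1 \<le> n \<Longrightarrow> z \<in> V \<Longrightarrow> 1 \<le> Re ((f ^^ n) z)"
  shows "normal_family_on V {f ^^ n |n. 1 \<le> n}"
proof (rule normal_family_on_norm_ge_1[OF assms(1,2)])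
  fix F z assume F: "F \<in> {f ^^ n |n. 1 \<le> n}"
  show "F holomorphic_on V" using F holomorphic_on_funpow[OF entire] by blast
  assume "z \<in> V"
  then show "1 \<le> norm (F z)"
    using F assms(3) complex_Re_le_cmod order_trans by blast
qed

lemma fatou_component_simply_connected:
  assumes U: "U \<in> fatou_components f"
  shows "simply_connected U"
proof (rule simply_connected_if_fills_frontier[OF open_fatou_set U])
  fix C assume C: "open C" "connected C" "bounded C" "frontier C \<subseteq> U"
  have "normal_family_on C {f ^^ n |n. 1 \<le> n}"
  proof (cases "\<exists>z\<in>U. \<exists>n. Re ((f ^^ n) z) \<le> 1")
    case True
    then obtain z B where z: "z \<in> U" "\<And>n. 1 \<le> n \<Longrightarrow> norm ((f ^^ n) z) \<le> B"
      using absorbed_orbit_bounded by blast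
    \<comment> \<open>The frontier of \<open>C\<close> is a compact subset of \<open>U\<close>, so
      one bound serves all iterates there; the maximum principle carries it into
      \<open>C\<close>.\<close>
    obtain M where M: "\<forall>n\<ge>1. \<forall>v\<in>frontier C. norm ((f ^^ n) v) \<le> M"
      using fatou_component_bounded_orbits_compact[OF entire U z _ C(4)] C(3) compact_frontier_bounded
      by blast
    have bound: "norm ((f ^^ n) v) \<le> M" if "1 \<le> n" "v \<in> C" for n v
    proof (rule maximum_modulus_frontier[of "f ^^ n" C])
      show "continuous_on (closure C) (f ^^ n)"
        using holomorphic_on_funpow[OF entire] holomorphic_on_imp_continuous_on by blast
    qed (use holomorphic_on_funpow[OF entire] M that C(3) in auto)
    show ?thesis
      by (rule normal_family_on_bounded[OF C(1), of _ M])
        (use bound holomorphic_on_funpow[OF entire] in auto)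
  next
    case False
    then have "1 \<le> Re ((f ^^ n) z)" if "z \<in> C" for n z
      using Re_ge_on_frontier[OF holomorphic_on_funpow[OF entire] C(3) _ that] C(4)
      by (meson less_imp_le not_le subsetD)
    then show ?thesis by (intro normal_if_Re_ge_1 C) auto
  qed
  then show "C \<subseteq> fatou_set f" by (intro normal_imp_subset_fatou_set C)
qed

text \<open>The Harnack constant is the same for all iterates, so nearby points have comparable real
  parts uniformly in \<open>n\<close>. Two-sided comparability is an equivalence relation and hence
  extends over the connected set \<open>U\<close>.\<close>

lemma Re_orbits_comparable:
  assumes U: "open U" "connected U" and pos: "\<And>n z. z \<in> U \<Longrightarrow> 0 < Re ((f ^^ n) z)"
    and "z \<in> U" "w \<in> U"
  shows "\<exists>c>0. \<forall>n. c * Re ((f ^^ n) z) \<le> Re ((f ^^ n) w)"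
proof -
  define R where "R x y \<longleftrightarrow> (\<exists>c>0. \<forall>n. c * Re ((f ^^ n) x) \<le> Re ((f ^^ n) y))" for x y
  have tr: "R x z" if xy: "R x y" and yz: "R y z" for x y z
  proof -
    obtain c d where cd: "c > 0" "\<And>n. c * Re ((f ^^ n) x) \<le> Re ((f ^^ n) y)"
       "d > 0" "\<And>n. d * Re ((f ^^ n) y) \<le> Re ((f ^^ n) z)"
      using xy yz unfolding R_def by blast
    have "d * c * Re ((f ^^ n) x) \<le> Re ((f ^^ n) z)" for n
      using mult_left_mono[OF cd(2)[of n], of d] cd(3) cd(4)[of n] unfolding mult.assoc by linarith
    then show ?thesis unfolding R_def using cd(1,3) by (intro exI[of _ "d * c"]) auto
  qed
  have "R z w \<and> R w z"
  proof (rule connected_equivalence_relation[of U _ _ "\<lambda>x y. R x y \<and> R y x"])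
    fix a assume a: "a \<in> U"
    then obtain r where r: "r > 0" "ball a r \<subseteq> U" using U(1) open_contains_ball by blast
    \<comment> \<open>Since 1/8 + 3/4 < 1, the ball of radius 3r/4 about \<open>x\<close> stays in
      \<open>ball a r\<close>; and \<open>y\<close> is within r/4 of \<open>x\<close>, less than
      half that radius.\<close>
    have near: "R x y" if "x \<in> ball a (r / 8)" "y \<in> ball a (r / 8)" for x y
    proof -
      have sub: "ball x (3 / 4 * r) \<subseteq> U"
      proof
        fix u assume "u \<in> ball x (3 / 4 * r)"
        then have "u \<in> ball a r"
          using that(1) dist_triangle[of a u x] r(1) by simp
        then show "u \<in> U" using r(2) by blast
      qed
      have "Re ((f ^^ n) x) \<le> 3 * Re ((f ^^ n) y)" for n
      proof (rule Harnack_half_ball[where F = "f ^^ n" and w = x and z = y and r = "3 / 4 * r"])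
        show "dist x y \<le> 3 / 4 * r / 2"
          using that r(1) dist_triangle3[of x y a]
          by simp
      qed (use sub pos r holomorphic_on_funpow[OF entire] in auto)
      then have "\<forall>n. 1 / 3 * Re ((f ^^ n) x) \<le> Re ((f ^^ n) y)" by (simp add: mult.commute)
      then show ?thesis unfolding R_def by (intro exI[of _ "1 / 3"]) simp
    qed
    show "\<exists>T. openin (top_of_set U) T \<and> a \<in> T \<and> (\<forall>x\<in>T. R a x \<and> R x a)"
    proof (intro exI[of _ "ball a (r / 8)"] conjI ballI)
      have "ball a (r / 8) \<subseteq> ball a r" using r(1) by (intro subset_ball) auto
      then have "ball a (r / 8) \<subseteq> U" using r(2) by blast
      then show "openin (top_of_set U) (ball a (r / 8))"
        by (simp add: openin_open_eq[OF U(1)])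
    qed (use near r in auto)
  next
    show "R x z \<and> R z x" if "R x y \<and> R y x" "R y z \<and> R z y" for x y z
      using that tr by blast
  qed (use assms in auto)
  then show ?thesis unfolding R_def by blast
qed

end

subsection \<open>Construction of the entire function\<close>

text \<open>The polynomial below has superattracting fixed points at 0 and 1. Iterating it improves a
  crude approximation of a function with values 0 and 1 on two sets to an arbitrarily good one.\<close>

definition smoothstep :: "complex \<Rightarrow> complex" where
  "smoothstep w = 3 * w\<^sup>2 - 2 * w ^ 3"

text \<open>This symmetry swaps the fixed points 0 and 1, so estimates near 0 also serve near
  1.\<close>

lemma smoothstep_one_minus: "smoothstep (1 - w) = 1 - smoothstep w"
  unfolding smoothstep_def by algebra

text \<open>After one factor \<open>w\<close> is split off, the rest has modulus at most 3/8 + 2/64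
  = 13/32 < 1/2.\<close>

lemma norm_smoothstep_le:
  assumes "norm w \<le> 1 / 8"
  shows "norm (smoothstep w) \<le> norm w / 2"
proof -
  have "smoothstep w = w * (3 * w - 2 * w * w)"
    by (simp add: smoothstep_def power2_eq_square power3_eq_cube algebra_simps)
  moreover have "norm (3 * w - 2 * w * w) \<le> 3 * norm w + 2 * norm w * norm w"
    by (rule order_trans[OF norm_triangle_ineq4]) (simp add: norm_mult)
  moreover have "2 * norm w * norm w \<le> 2 * norm w * (1 / 8)"
    using assms by (intro mult_left_mono) auto
  ultimately have "norm (smoothstep w) \<le> norm w * (1 / 2)"
    using assms by (auto simp: norm_mult simp del: times_divide_eq_right intro!: mult_left_mono)
  then show ?thesis by simp
qed

lemma norm_smoothstep_funpow_le:
  assumes "norm w \<le> 1 / 8"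
  shows "norm ((smoothstep ^^ N) w) \<le> (1 / 2) ^ N / 8"
proof (induction N)
  case (Suc N)
  have "(1 / 2 :: real) ^ N \<le> 1" by (simp add: power_le_one)
  with Suc have "norm ((smoothstep ^^ N) w) \<le> 1 / 8" by simp
  from norm_smoothstep_le[OF this] Suc show ?case by simp
qed (use assms in simp)

lemma smoothstep_funpow_one_minus: "(smoothstep ^^ N) (1 - w) = 1 - (smoothstep ^^ N) w"
  by (induction N) (simp_all add: smoothstep_one_minus)

lemma smoothstep_holomorphic: "smoothstep holomorphic_on A"
proof -
  have "(\<lambda>w. 3 * w\<^sup>2 - 2 * w ^ 3 :: complex) holomorphic_on A"
    by (intro holomorphic_intros)
  then show ?thesis by (simp add: smoothstep_def[abs_def])
qed

text \<open>The function 1 - exp (- E z) is within 1/8 of 0 where \<open>E\<close> is small, and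
  within 1/8 of 1 where the real part of \<open>E\<close> is large. Iterates of
  \<open>smoothstep\<close> reduce both errors below \<delta>.\<close>

lemma entire_approx_step:
  assumes "16 \<le> a" "0 < \<delta>"
  obtains \<phi> where "\<phi> holomorphic_on UNIV"
    "\<And>z. Re z \<le> a / 2 \<Longrightarrow> norm (\<phi> z) \<le> \<delta>"
    "\<And>z. z \<in> ball (of_real a) 1 \<Longrightarrow> norm (1 - \<phi> z) \<le> \<delta>"
proof -
  \<comment> \<open>The shift 3a/4 is midway between a/2 and a: the exponent has real part at most
    -a/4 \<le> -4 on the half-plane and at least a/4 - 1 \<ge> 3 on the disc.\<close>
  define E where "E z = exp (z - of_real (3 * a / 4))" for z :: complex
  obtain N where N: "(1 / 2 :: real) ^ N < \<delta>"
    using real_arch_pow_inv[OF assms(2), of "1 / 2"] by auto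
  define \<phi> where "\<phi> z = (smoothstep ^^ N) (1 - exp (- E z))" for z
  have e1: "2 \<le> exp (1 :: real)"
    using exp_ge_add_one_self[of 1] by linarith
  have exp_pow: "2 ^ k \<le> exp (real k)" for k
    using power_mono[OF e1, of k] by (simp add: exp_of_nat_mult[of k 1, simplified])
  have "(\<lambda>z. 1 - exp (- E z)) holomorphic_on UNIV"
    unfolding E_def by (intro holomorphic_intros)
  then have hol: "\<phi> holomorphic_on UNIV"
    using holomorphic_on_compose_gen[OF _ holomorphic_on_funpow[OF smoothstep_holomorphic]]
    unfolding \<phi>_def[abs_def] o_def by blast
  have small: "norm ((smoothstep ^^ N) w) \<le> \<delta>" if "norm w \<le> 1 / 8" for w
    using norm_smoothstep_funpow_le[OF that, of N] N assms(2) by linarith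
  have left: "norm (\<phi> z) \<le> \<delta>" if "Re z \<le> a / 2" for z
  proof -
    have "norm (E z) \<le> exp (- 4)"
      using that assms(1) by (simp add: E_def)
    also have "\<dots> \<le> 1 / 16"
      using exp_pow[of 4] by (simp add: exp_minus field_simps)
    finally have E: "norm (E z) \<le> 1 / 16" .
    have "norm (exp (- E z) - 1) \<le> 3 / 2 * norm (- E z)"
      using E by (intro norm_exp_bounds) auto
    then have "norm (1 - exp (- E z)) \<le> 1 / 8"
      using E by (simp add: norm_minus_commute)
    then show ?thesis unfolding \<phi>_def by (rule small)
  qed
  have right: "norm (1 - \<phi> z) \<le> \<delta>" if z: "z \<in> ball (of_real a) 1" for z
  proof -
    have d: "norm (z - of_real a) < 1" using z by (simp add: dist_norm norm_minus_commute)
    have "\<bar>Re z - a\<bar> < 1" "\<bar>Im z\<bar> < 1"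
      using abs_Re_le_cmod[of "z - of_real a"] abs_Im_le_cmod[of "z - of_real a"] d by auto
    then have re: "3 \<le> Re z - 3 * a / 4" and im: "\<bar>Im z\<bar> \<le> pi / 3"
      using assms(1) pi_gt3 by linarith+
    \<comment> \<open>The disc is so small that the argument of \<open>E\<close> stays below pi/3,
      so at least half of its modulus survives as real part.\<close>
    have "1 / 2 \<le> cos \<bar>Im z\<bar>"
      using cos_monotone_0_pi_le[of "\<bar>Im z\<bar>" "pi / 3"] im by (simp add: cos_60)
    then have "1 / 2 \<le> cos (Im z)" by simp
    moreover have "8 \<le> exp (Re z - 3 * a / 4)"
    proof -
      have "8 \<le> exp (3 :: real)" using exp_pow[of 3] by simp
      also have "\<dots> \<le> exp (Re z - 3 * a / 4)" using re by simp
      finally show ?thesis .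
    qed
    ultimately have "8 * (1 / 2) \<le> exp (Re z - 3 * a / 4) * cos (Im z)"
      by (intro mult_mono) auto
    then have "4 \<le> Re (E z)" by (simp add: E_def Re_exp)
    then have "norm (exp (- E z)) \<le> exp (- 4)" by simp
    also have "\<dots> \<le> 1 / 8"
      using exp_pow[of 4] by (simp add: exp_minus field_simps)
    finally show ?thesis
      unfolding \<phi>_def smoothstep_funpow_one_minus using small by simp
  qed
  show thesis by (rule that[OF hol left right])
qed

text \<open>The new function is S + (a' - S) \<phi>. First \<open>a'\<close> is fixed from a bound
  for \<open>S\<close> on a disc, and only then the accuracy of \<phi>, so the size of
  \<open>a'\<close> does no harm. On the unbounded half-plane, \<open>B\<close> is what controls a'
  - S.\<close>

lemma entire_correction_step:
  fixes S :: "complex \<Rightarrow> complex"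
  assumes a: "16 \<le> a" and S: "S holomorphic_on UNIV" "\<And>z. Re z \<le> 1 \<Longrightarrow> norm (S z) \<le> B"
    and \<epsilon>: "0 < \<epsilon>" and c: "0 \<le> c"
  obtains a' S' where "2 * a + 2 \<le> a'" "S' holomorphic_on UNIV"
    "\<And>z. norm z \<le> a / 2 \<Longrightarrow> c * (norm (S z) + 1) \<le> a'"
    "\<And>z. Re z \<le> 1 \<or> norm z \<le> a / 2 \<Longrightarrow> norm (S' z - S z) \<le> \<epsilon>"
    "\<And>z. z \<in> ball (of_real a) 1 \<Longrightarrow> norm (S' z - of_real a') \<le> \<epsilon>"
proof -
  have "continuous_on (cball 0 (a + 1)) S"
    using S(1) holomorphic_on_imp_continuous_on continuous_on_subset by blast
  then have "bounded (S ` cball 0 (a + 1))"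
    by (intro compact_imp_bounded compact_continuous_image compact_cball)
  then obtain M where "\<forall>y\<in>S ` cball 0 (a + 1). norm y \<le> M"
    unfolding bounded_iff by blast
  then have M: "norm (S z) \<le> M" if "norm z \<le> a + 1" for z
    using that by simp
  define a' where "a' = max (2 * a + 2) (c * (M + 1))"
  \<comment> \<open>\<open>D\<close> dominates a' - S on the half-plane and on the disc of radius a
    + 1; the summand 1 makes it positive.\<close>
  define D where "D = \<bar>B\<bar> + \<bar>M\<bar> + \<bar>a'\<bar> + 1"
  have D: "0 < D" by (simp add: D_def add_nonneg_pos)
  obtain \<phi> where \<phi>: "\<phi> holomorphic_on UNIV" "\<And>z. Re z \<le> a / 2 \<Longrightarrow> norm (\<phi> z) \<le> \<epsilon> / D"
    "\<And>z. z \<in> ball (of_real a) 1 \<Longrightarrow> norm (1 - \<phi> z) \<le> \<epsilon> / D"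
    by (rule entire_approx_step[OF a divide_pos_pos[OF \<epsilon> D]]) (rule that)
  have prod_le: "norm ((of_real a' - S z) * w) \<le> \<epsilon>"
    if z: "Re z \<le> 1 \<or> norm z \<le> a + 1" and w: "norm w \<le> \<epsilon> / D" for z w
  proof -
    have "norm (S z) \<le> \<bar>B\<bar> + \<bar>M\<bar>" using S(2)[of z] M[of z] z by linarith
    then have "norm (of_real a' - S z) \<le> D"
      using norm_triangle_ineq4[of "of_real a'" "S z"] by (simp add: D_def)
    then have "norm ((of_real a' - S z) * w) \<le> D * (\<epsilon> / D)"
      unfolding norm_mult using w D by (intro mult_mono) auto
    then show ?thesis using D by simp
  qed
  show thesis
  proof (rule that[of a' "\<lambda>z. S z + (of_real a' - S z) * \<phi> z"])
    show "2 * a + 2 \<le> a'" by (simp add: a'_def)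
    show "(\<lambda>z. S z + (of_real a' - S z) * \<phi> z) holomorphic_on UNIV"
      by (intro holomorphic_intros S \<phi>)
    show "c * (norm (S z) + 1) \<le> a'" if "norm z \<le> a / 2" for z
    proof -
      have "c * (norm (S z) + 1) \<le> c * (M + 1)"
        using M[of z] that a c by (intro mult_left_mono) auto
      then show ?thesis by (simp add: a'_def)
    qed
    show "norm (S z + (of_real a' - S z) * \<phi> z - S z) \<le> \<epsilon>" if "Re z \<le> 1 \<or> norm z \<le> a / 2" for z
    proof -
      have "Re z \<le> a / 2" using that complex_Re_le_cmod[of z] a by linarith
      then show ?thesis using prod_le[of z "\<phi> z"] \<phi>(2) that a by auto
    qed
    show "norm (S z + (of_real a' - S z) * \<phi> z - of_real a') \<le> \<epsilon>" if z: "z \<in> ball (of_real a) 1" for z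
    proof -
      have "norm z \<le> norm (of_real a :: complex) + norm (z - of_real a)"
        by (rule norm_triangle_sub)
      moreover have "norm (z - of_real a) < 1" using z by (simp add: dist_norm norm_minus_commute)
      ultimately have nz: "norm z \<le> a + 1" using a by simp
      have "S z + (of_real a' - S z) * \<phi> z - of_real a' = - ((of_real a' - S z) * (1 - \<phi> z))"
        by (simp add: algebra_simps)
      then show ?thesis using prod_le[of z "1 - \<phi> z"] \<phi>(3)[OF z] nz by (simp del: mult_minus_left mult_minus_right)
    qed
  qed
qed

text \<open>Stage \<open>n\<close> has tolerance (1/2)^(n+2), so all changes from stage
  \<open>n\<close> on total at most (1/2)^(n+1) where |z| \<le> a n / 2. As a n tends to infinity,
  the approximations converge locally uniformly on the plane.\<close>

lemma entire_fast_wandering_discs: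
  obtains f :: "complex \<Rightarrow> complex" and a :: "nat \<Rightarrow> real" where
    "f holomorphic_on UNIV" "\<And>z. Re z \<le> 1 \<Longrightarrow> norm (f z) \<le> 1 / 2"
    "\<And>n. 16 \<le> a n" "\<And>n. 2 * a n + 2 \<le> a (Suc n)"
    "\<And>n z. norm z \<le> a n / 2 \<Longrightarrow> real (Suc n) * norm (f z) \<le> a (Suc n)"
    "\<And>n z. z \<in> ball (of_real (a n)) 1 \<Longrightarrow> norm (f z - of_real (a (Suc n))) \<le> 1 / 2"
proof -
  \<comment> \<open>\<open>P\<close> is the invariant of one pair (a n, S n), and \<open>Q\<close>
    links consecutive pairs. Starting from the zero function lets the error estimate at stage 0
    bound the limit itself by 1/2 on the half-plane.\<close>
  define P :: "nat \<Rightarrow> real \<times> (complex \<Rightarrow> complex) \<Rightarrow> bool" where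
    "P n = (\<lambda>(a, S). 16 \<le> a \<and> S holomorphic_on UNIV \<and> (\<exists>B. \<forall>z. Re z \<le> 1 \<longrightarrow> norm (S z) \<le> B) \<and>
       (n = 0 \<longrightarrow> S = (\<lambda>_. 0)))" for n
  define Q :: "nat \<Rightarrow> real \<times> (complex \<Rightarrow> complex) \<Rightarrow> real \<times> (complex \<Rightarrow> complex) \<Rightarrow> bool" where
    "Q n = (\<lambda>(a, S) (a', S'). 2 * a + 2 \<le> a' \<and>
       (\<forall>z. norm z \<le> a / 2 \<longrightarrow> real (Suc n) * (norm (S z) + 1) \<le> a') \<and>
       (\<forall>z. Re z \<le> 1 \<or> norm z \<le> a / 2 \<longrightarrow> norm (S' z - S z) \<le> (1 / 2) ^ (n + 2)) \<and>
       (\<forall>z\<in>ball (of_real a) 1. norm (S' z - of_real a') \<le> (1 / 2) ^ (n + 2)))" for n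
  have "\<exists>X. \<forall>n. P n (X n) \<and> Q n (X n) (X (Suc n))"
  proof (rule dependent_nat_choice)
    show "\<exists>x. P 0 x"
      by (rule exI[of _ "(16, \<lambda>_. 0)"]) (auto simp: P_def)
    fix x n assume "P n x"
    then obtain a S B where x: "x = (a, S)" and aS: "16 \<le> a" "S holomorphic_on UNIV"
      "\<And>z. Re z \<le> 1 \<Longrightarrow> norm (S z) \<le> B"
      unfolding P_def by auto
    obtain a' S' where s: "2 * a + 2 \<le> a'" "S' holomorphic_on UNIV"
      "\<And>z. norm z \<le> a / 2 \<Longrightarrow> real (Suc n) * (norm (S z) + 1) \<le> a'"
      "\<And>z. Re z \<le> 1 \<or> norm z \<le> a / 2 \<Longrightarrow> norm (S' z - S z) \<le> (1 / 2) ^ (n + 2)"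
      "\<And>z. z \<in> ball (of_real a) 1 \<Longrightarrow> norm (S' z - of_real a') \<le> (1 / 2) ^ (n + 2)"
      by (rule entire_correction_step[OF aS, of "(1 / 2) ^ (n + 2)" "real (Suc n)"]) auto
    have "norm (S' z) \<le> B + (1 / 2) ^ (n + 2)" if "Re z \<le> 1" for z
      using s(4)[of z] aS(3)[of z] norm_triangle_sub[of "S' z" "S z"] that by linarith
    then have "P (Suc n) (a', S')"
      using s(1,2) aS(1) unfolding P_def by auto
    moreover have "Q n x (a', S')"
      using s unfolding Q_def x by blast
    ultimately show "\<exists>y. P (Suc n) y \<and> Q n x y" by blast
  qed
  then obtain X where X: "\<And>n. P n (X n)" "\<And>n. Q n (X n) (X (Suc n))" by blast
  define a where "a n = fst (X n)" for n
  define S where "S n = snd (X n)" for n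
  have Xn: "X n = (a n, S n)" for n by (simp add: a_def S_def)
  have a16: "16 \<le> a n" and hol: "S n holomorphic_on UNIV" and S0: "S 0 = (\<lambda>_. 0)" for n
    using X(1)[of n] X(1)[of 0] unfolding P_def Xn by auto
  have step: "2 * a n + 2 \<le> a (Suc n)"
    and growth: "norm z \<le> a n / 2 \<Longrightarrow> real (Suc n) * (norm (S n z) + 1) \<le> a (Suc n)"
    and incr: "Re z \<le> 1 \<or> norm z \<le> a n / 2 \<Longrightarrow> norm (S (Suc n) z - S n z) \<le> (1 / 2) ^ (n + 2)"
    and disc: "z \<in> ball (of_real (a n)) 1 \<Longrightarrow> norm (S (Suc n) z - of_real (a (Suc n))) \<le> (1 / 2) ^ (n + 2)"
    for n z
    using X(2)[of n] unfolding Q_def Xn by blast+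
  have "mono a" by (rule incseq_SucI) (use step a16 in \<open>smt (verit)\<close>)
  then have a_mono: "a n \<le> a m" if "n \<le> m" for n m using that by (auto dest: monoD)
  have a_ge: "real n \<le> a n / 2" for n
  proof (induction n)
    case 0 then show ?case using a16[of 0] by simp
  next
    case (Suc n) then show ?case using step[of n] a16[of n] by simp
  qed
  \<comment> \<open>The bound is the exact geometric sum, in the form that lets the induction
    close.\<close>
  have diff: "norm (S (n + k) z - S n z) \<le> (1 / 2) ^ (n + 1) - (1 / 2) ^ (n + k + 1)"
    if z: "Re z \<le> 1 \<or> norm z \<le> a n / 2" for n k z
  proof (induction k)
    case (Suc k)
    have "norm (S (Suc (n + k)) z - S (n + k) z) \<le> (1 / 2) ^ (n + k + 2)"
      using z a_mono[of n "n + k"] by (intro incr) auto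
    with Suc have "norm (S (Suc (n + k)) z - S n z) \<le>
        (1 / 2) ^ (n + 1) - (1 / 2) ^ (n + k + 1) + (1 / 2) ^ (n + k + 2)"
      using norm_triangle_ineq[of "S (Suc (n + k)) z - S (n + k) z" "S (n + k) z - S n z"] by simp
    then show ?case by simp
  qed simp
  define f where "f z = lim (\<lambda>n. S n z)" for z
  have approx: "norm (f z - S n z) \<le> (1 / 2) ^ (n + 1)"
    if z: "Re z \<le> 1 \<or> norm z \<le> a n / 2" for n z
  proof -
    have "summable (\<lambda>k. S (n + Suc k) z - S (n + k) z)"
    proof (rule summable_comparison_test)
      show "\<exists>N. \<forall>k\<ge>N. norm (S (n + Suc k) z - S (n + k) z) \<le> (1 / 2) ^ k"
      proof (intro exI allI impI)
        fix k
        have "norm (S (Suc (n + k)) z - S (n + k) z) \<le> (1 / 2) ^ (n + k + 2)"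
          using z a_mono[of n "n + k"] by (intro incr) auto
        also have "\<dots> \<le> (1 / 2) ^ k" by (rule power_decreasing) auto
        finally show "norm (S (n + Suc k) z - S (n + k) z) \<le> (1 / 2) ^ k" by simp
      qed
    qed (auto intro: summable_geometric)
    from summable_LIMSEQ[OF this]
    obtain s where "(\<lambda>m. S (n + m) z - S n z) \<longlonglongrightarrow> s"
      using sum_lessThan_telescope[of "\<lambda>k. S (n + k) z"] by auto
    from tendsto_add[OF this tendsto_const[of "S n z"]]
    have "(\<lambda>m. S (m + n) z) \<longlonglongrightarrow> s + S n z" by (simp add: add.commute)
    then have "(\<lambda>m. S m z) \<longlonglongrightarrow> s + S n z" by (rule LIMSEQ_offset)
    then have "(\<lambda>k. S k z) \<longlonglongrightarrow> f z" by (simp add: f_def limI)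
    then have "(\<lambda>k. S (k + n) z) \<longlonglongrightarrow> f z" by (rule LIMSEQ_ignore_initial_segment)
    then have "(\<lambda>k. norm (S (k + n) z - S n z)) \<longlonglongrightarrow> norm (f z - S n z)"
      by (intro tendsto_intros)
    moreover have "norm (S (k + n) z - S n z) \<le> (1 / 2) ^ (n + 1)" for k
      using diff[OF z, of k] zero_le_power[of "1 / 2 :: real" "n + k + 1"]
      unfolding add.commute[of k n] by linarith
    ultimately show ?thesis by (intro LIMSEQ_le_const2) auto
  qed
  show thesis
  proof (rule that[of f a])
    show "f holomorphic_on UNIV"
    proof (rule holomorphic_uniform_sequence[OF open_UNIV hol])
      fix x :: complex
      obtain N :: nat where N: "norm x + 1 \<le> real N" using real_arch_simple by blast
      have "uniform_limit (cball x 1) S f sequentially"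
      proof (rule uniform_limitI)
        fix e :: real assume "0 < e"
        then have "\<forall>\<^sub>F n in sequentially. (1 / 2) ^ (n + 1) < e"
          using order_tendstoD(2)[OF LIMSEQ_ignore_initial_segment[OF LIMSEQ_power_zero[of "1 / 2 :: real"], of 1]]
          by simp
        moreover have "\<forall>\<^sub>F n in sequentially. N \<le> n" by (rule eventually_ge_at_top)
        ultimately show "\<forall>\<^sub>F n in sequentially. \<forall>z\<in>cball x 1. dist (S n z) (f z) < e"
        proof eventually_elim
          case (elim n)
          show ?case
          proof
            fix z assume "z \<in> cball x 1"
            then have "norm z \<le> norm x + 1"
              using norm_triangle_sub[of z x] by (simp add: dist_norm norm_minus_commute)
            then have "norm z \<le> a n / 2" using N elim(2) a_ge[of n] by linarith
            then show "dist (S n z) (f z) < e"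
              using approx[of z n] elim(1) by (simp add: dist_norm norm_minus_commute)
          qed
        qed
      qed
      then show "\<exists>d>0. cball x d \<subseteq> UNIV \<and> uniform_limit (cball x d) S f sequentially"
        by (intro exI[of _ 1]) auto
    qed
    show "norm (f z) \<le> 1 / 2" if "Re z \<le> 1" for z
      using approx[of z 0] that by (simp add: S0)
    show "real (Suc n) * norm (f z) \<le> a (Suc n)" if "norm z \<le> a n / 2" for n z
    proof -
      have "(1 / 2 :: real) ^ (n + 1) \<le> 1" by (rule power_le_one) auto
      then have "norm (f z) \<le> norm (S n z) + 1"
        using approx[of z n] that norm_triangle_sub[of "f z" "S n z"] by linarith
      then have "real (Suc n) * norm (f z) \<le> real (Suc n) * (norm (S n z) + 1)"
        by (intro mult_left_mono) auto
      also have "\<dots> \<le> a (Suc n)" using growth that by blast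
      finally show ?thesis .
    qed
    show "norm (f z - of_real (a (Suc n))) \<le> 1 / 2" if z: "z \<in> ball (of_real (a n)) 1" for n z
    proof -
      have "norm z \<le> norm (of_real (a n) :: complex) + norm (z - of_real (a n))"
        using norm_triangle_sub[of z "of_real (a n)"] .
      \<comment> \<open>The summand 2 in \<open>step\<close> puts the whole disc around a n into the
        region where stage n + 1 is already accurate.\<close>
      then have "norm z \<le> a (Suc n) / 2"
        using z step[of n] a16[of n] by (simp add: dist_norm norm_minus_commute)
      then have "norm (f z - S (Suc n) z) \<le> (1 / 2) ^ (n + 2)"
        using approx[of z "Suc n"] by simp
      then have "norm (f z - of_real (a (Suc n))) \<le> (1 / 2) ^ (n + 2) + (1 / 2) ^ (n + 2)"
        using disc[OF z] norm_triangle_ineq[of "f z - S (Suc n) z" "S (Suc n) z - of_real (a (Suc n))"]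
        by simp
      also have "\<dots> = (1 / 2) ^ (n + 1)" by simp
      also have "\<dots> \<le> 1 / 2"
        using power_le_one[of "1 / 2 :: real" n] by simp
      finally show ?thesis .
    qed
  qed (use a16 step in auto)
qed

subsection \<open>Fast escape\<close>

text \<open>A nonconstant polynomial has modulus at least 1 far out on the negative real axis; a
  constant is excluded by the value at \<open>w\<close>.\<close>

lemma not_polynomial_if_bounded_left_half_plane:
  assumes "\<And>z. Re z \<le> 1 \<Longrightarrow> norm (f z) \<le> 1 / 2" and "1 < norm (f w)"
  shows "f \<noteq> poly p"
proof
  assume f: "f = poly p"
  obtain c q where p: "p = pCons c q" by (cases p)
  show False
  proof (cases "q = 0")
    case True
    then show False using assms(1)[of 0] assms(2) by (simp add: f p)
  next
    case False
    then obtain r where r: "\<And>z. r \<le> norm z \<Longrightarrow> 1 \<le> norm (f z)"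
      using poly_infinity[of q 1 c] by (auto simp: f p)
    show False
      using r[of "- of_real \<bar>r\<bar>"] assms(1)[of "- of_real \<bar>r\<bar>"] abs_ge_zero[of r] abs_ge_self[of r] by simp
  qed
qed

locale fast_wandering_discs = absorbing_half_plane +
  fixes a :: "nat \<Rightarrow> real"
  assumes ge_16: "\<And>n. 16 \<le> a n"
    and doubling: "\<And>n. 2 * a n + 2 \<le> a (Suc n)"
    and growth: "\<And>n z. norm z \<le> a n / 2 \<Longrightarrow> real (Suc n) * norm (f z) \<le> a (Suc n)"
    and disc: "\<And>n z. z \<in> ball (of_real (a n)) 1 \<Longrightarrow> norm (f z - of_real (a (Suc n))) \<le> 1 / 2"
begin

lemma a_mono: "n \<le> m \<Longrightarrow> a n \<le> a m"
proof (induction m rule: dec_induct)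
  case (step m)
  then show ?case using doubling[of m] ge_16[of m] by simp
qed simp

lemma a_ge: "real n + 16 \<le> a n"
proof (induction n)
  case (Suc n)
  then show ?case using doubling[of n] ge_16[of n] by simp
qed (use ge_16[of 0] in simp)

lemma orbit_in_disc:
  assumes "z \<in> ball (of_real (a 0)) 1"
  shows "(f ^^ n) z \<in> ball (of_real (a n)) 1"
proof (induction n)
  case (Suc n)
  from disc[OF this] show ?case by (simp add: dist_norm norm_minus_commute)
qed (use assms in simp)

lemma Re_orbit_ge:
  assumes "z \<in> ball (of_real (a 0)) 1"
  shows "a n - 1 \<le> Re ((f ^^ n) z)"
  using orbit_in_disc[OF assms, of n] abs_Re_le_cmod[of "of_real (a n) - (f ^^ n) z"]
  by (simp add: dist_norm)

lemma transcendental: "transcendental_entire f"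
proof -
  have "a 1 - 1 \<le> norm (f (of_real (a 0)))"
    using Re_orbit_ge[of "of_real (a 0)" 1] complex_Re_le_cmod[of "f (of_real (a 0))"] by simp
  then have "1 < norm (f (of_real (a 0)))" using ge_16[of 1] by simp
  then show ?thesis
    using not_polynomial_if_bounded_left_half_plane[of f, OF small] entire
    unfolding transcendental_entire_def by blast
qed

lemma disc_subset_fatou_set: "ball (of_real (a 0)) 1 \<subseteq> fatou_set f"
proof (rule normal_imp_subset_fatou_set)
  show "normal_family_on (ball (of_real (a 0)) 1) {f ^^ n |n. 1 \<le> n}"
  proof (rule normal_if_Re_ge_1)
    show "1 \<le> Re ((f ^^ n) z)" if "z \<in> ball (of_real (a 0)) 1" for n z
      using Re_orbit_ge[OF that, of n] ge_16[of n] by linarith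
  qed auto
qed auto

text \<open>An orbit from \<open>U\<close> entering the half-plane would be bounded, and boundedness
  would spread to the orbit of \<open>a 0\<close>, which tends to infinity.\<close>

lemma Re_orbit_gt_1:
  assumes U: "U \<in> fatou_components f" "of_real (a 0) \<in> U" and z: "z \<in> U"
  shows "1 < Re ((f ^^ n) z)"
proof (rule ccontr)
  assume "\<not> ?thesis"
  then have "Re ((f ^^ n) z) \<le> 1" by simp
  from absorbed_orbit_bounded[OF this]
  obtain B where B: "\<And>m. 1 \<le> m \<Longrightarrow> norm ((f ^^ m) z) \<le> B" by blast
  from fatou_component_bounded_orbits_compact[OF entire U(1) z B, of "{of_real (a 0)}"] U(2)
  obtain M where M: "\<And>m. 1 \<le> m \<Longrightarrow> norm ((f ^^ m) (of_real (a 0))) \<le> M" by auto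
  obtain m :: nat where m: "M \<le> real m" using real_arch_simple by blast
  have "a (Suc m) - 1 \<le> Re ((f ^^ Suc m) (of_real (a 0)))" by (rule Re_orbit_ge) simp
  also have "\<dots> \<le> M" using complex_Re_le_cmod M[of "Suc m"] by (rule order_trans) simp
  finally show False using m a_ge[of "Suc m"] by simp
qed

section \<open>Growth of the iterated maximum modulus\<close>

lemma admissible_radius_a0: "admissible_radius f (a 0)"
  unfolding admissible_radius_def
proof (intro conjI allI impI)
  show "0 < a 0" using ge_16[of 0] by simp
  fix r assume r: "a 0 \<le> r"
  obtain m :: nat where "r \<le> real m" using real_arch_simple by blast
  then have ex: "\<exists>n. r < a (Suc n) - 1 / 2"
    using a_ge[of "Suc m"] by (intro exI[of _ m]) simp
  \<comment> \<open>The intervals from a n - 1/2 to a (n+1) - 1/2 cover all r \<ge> a 0, and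
    \<open>n\<close> picks the one containing \<open>r\<close>. The shift matches the error in
    \<open>disc\<close>: the left end point is in the n-th disc, and its image has modulus at least
    the right end point.\<close>
  define n where "n = (LEAST n. r < a (Suc n) - 1 / 2)"
  have n: "r < a (Suc n) - 1 / 2" unfolding n_def using ex by (rule LeastI_ex)
  have lower: "a n - 1 / 2 \<le> r"
  proof (cases n)
    case 0
    then show ?thesis using r by simp
  next
    case (Suc k)
    then have "\<not> r < a (Suc k) - 1 / 2" by (intro not_less_Least) (simp add: n_def)
    then show ?thesis using Suc by simp
  qed
  let ?w = "of_real (a n - 1 / 2) :: complex"
  have "?w \<in> ball (of_real (a n)) 1" by (simp add: dist_norm)
  from disc[OF this] have "a (Suc n) - 1 / 2 \<le> norm (f ?w)"
    using norm_triangle_ineq3[of "f ?w" "of_real (a (Suc n))"] ge_16[of "Suc n"] by simp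
  also have "\<dots> \<le> max_modulus f r"
    using lower ge_16[of n] by (intro max_modulus_bound[OF entire]) (simp del: of_real_diff)
  finally show "r < max_modulus f r" using n by linarith
qed

lemma max_modulus_le:
  assumes "0 \<le> x" "x \<le> a n / 2"
  shows "real (Suc n) * max_modulus f x \<le> a (Suc n)"
proof -
  obtain z where "norm z = x" "norm (f z) = max_modulus f x"
    using max_modulus_attained(1)[OF entire assms(1)] by blast
  then show ?thesis using growth[of z n] assms(2) by simp
qed

text \<open>The half keeps every iterate in the range where \<open>growth\<close> applies, and the
  growth factor n + l + 1 \<ge> 2 restores it.\<close>

lemma max_modulus_funpow_le_half:
  assumes "1 \<le> l"
  shows "(max_modulus f ^^ n) (a 0) \<le> a (n + l) / 2"
proof (induction n)
  case 0
  have "2 * a 0 + 2 \<le> a l" using doubling[of 0] a_mono[OF assms] by simp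
  then show ?case by simp
next
  case (Suc n)
  let ?x = "(max_modulus f ^^ n) (a 0)"
  have x: "0 \<le> ?x" and y: "0 \<le> max_modulus f ?x"
    using max_modulus_funpow_ge[OF admissible_radius_a0, of n] ge_16[of 0]
      max_modulus_funpow_ge[OF admissible_radius_a0, of "Suc n"] by simp_all
  have "2 * max_modulus f ?x \<le> real (Suc (n + l)) * max_modulus f ?x"
    using assms y by (intro mult_right_mono) auto
  also have "\<dots> \<le> a (Suc (n + l))" by (rule max_modulus_le[OF x Suc])
  finally show ?case by simp
qed

text \<open>The last application of \<open>growth\<close> keeps its factor, at least
  \<open>l\<close>. A larger shift \<open>l\<close> thus buys an arbitrarily large constant, enough
  to absorb the one from Harnack.\<close>

lemma max_modulus_funpow_le:
  assumes "1 \<le> l" "1 \<le> n"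
  shows "real l * (max_modulus f ^^ n) (a 0) \<le> a (n + l)"
proof -
  obtain k where k: "n = Suc k" using assms(2) by (cases n) auto
  let ?x = "(max_modulus f ^^ k) (a 0)"
  have x: "0 \<le> ?x" and y: "0 \<le> max_modulus f ?x"
    using max_modulus_funpow_ge[OF admissible_radius_a0, of k] ge_16[of 0]
      max_modulus_funpow_ge[OF admissible_radius_a0, of "Suc k"] by simp_all
  have "real l * max_modulus f ?x \<le> real (Suc (k + l)) * max_modulus f ?x"
    using y by (intro mult_right_mono) auto
  also have "\<dots> \<le> a (Suc (k + l))"
    by (rule max_modulus_le[OF x max_modulus_funpow_le_half[OF assms(1)]])
  finally show ?thesis by (simp add: k)
qed

lemma fatou_component_subset_fast_escaping_set:
  assumes U: "U \<in> fatou_components f" "of_real (a 0) \<in> U"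
  shows "U \<subseteq> fast_escaping_set f"
proof
  fix w assume w: "w \<in> U"
  have "\<exists>c>0. \<forall>n. c * Re ((f ^^ n) (of_real (a 0))) \<le> Re ((f ^^ n) w)"
  proof (rule Re_orbits_comparable)
    show "open U" using open_components[OF open_fatou_set U(1)] .
    show "0 < Re ((f ^^ n) z)" if "z \<in> U" for n z
      using Re_orbit_gt_1[OF U that, of n] by linarith
  qed (use U w in_components_connected in auto)
  then obtain c where c: "0 < c" "\<And>n. c * Re ((f ^^ n) (of_real (a 0))) \<le> Re ((f ^^ n) w)"
    by blast
  \<comment> \<open>The shift may depend on \<open>w\<close> through \<open>c\<close>. It makes c l
    / 2 \<ge> 1, where the half pays for a - 1 \<ge> a / 2 below.\<close>
  obtain l0 :: nat where l0: "2 / c \<le> real l0" using real_arch_simple by blast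
  define l where "l = Suc l0"
  have l: "1 \<le> l" "1 \<le> c / 2 * real l"
    using l0 c(1) by (auto simp: l_def field_simps)
  have "(max_modulus f ^^ n) (a 0) \<le> norm ((f ^^ (n + l)) w)" if n: "1 \<le> n" for n
  proof -
    let ?x = "(max_modulus f ^^ n) (a 0)"
    have "0 \<le> ?x"
      using max_modulus_funpow_ge[OF admissible_radius_a0, of n] ge_16[of 0] by linarith
    then have "?x \<le> c / 2 * real l * ?x" using mult_right_mono[OF l(2)] by simp
    also have "\<dots> = c * (real l * ?x / 2)" by simp
    also have "\<dots> \<le> c * (a (n + l) - 1)"
      using max_modulus_funpow_le[OF l(1) n] ge_16[of "n + l"] c(1) by (intro mult_left_mono) auto
    also have "\<dots> \<le> c * Re ((f ^^ (n + l)) (of_real (a 0)))"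
      using c(1) Re_orbit_ge[of "of_real (a 0)" "n + l"] by (intro mult_left_mono) auto
    also have "\<dots> \<le> Re ((f ^^ (n + l)) w)" by (rule c(2))
    also have "\<dots> \<le> norm ((f ^^ (n + l)) w)" by (rule complex_Re_le_cmod)
    finally show ?thesis .
  qed
  then show "w \<in> fast_escaping_set f"
    unfolding fast_escaping_set_def using admissible_radius_a0 l(1) by blast
qed

end

theorem theorem1:
  shows "\<exists>f :: complex \<Rightarrow> complex. transcendental_entire f \<and>
    (\<exists>U \<in> fatou_components f. simply_connected U \<and> U \<subseteq> fast_escaping_set f) \<and>
    \<not> (\<exists>U \<in> fatou_components f. multiply_connected U)"
proof -
  obtain f :: "complex \<Rightarrow> complex" and a :: "nat \<Rightarrow> real" where
    "f holomorphic_on UNIV" "\<And>z. Re z \<le> 1 \<Longrightarrow> norm (f z) \<le> 1 / 2"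
    "\<And>n. 16 \<le> a n" "\<And>n. 2 * a n + 2 \<le> a (Suc n)"
    "\<And>n z. norm z \<le> a n / 2 \<Longrightarrow> real (Suc n) * norm (f z) \<le> a (Suc n)"
    "\<And>n z. z \<in> ball (of_real (a n)) 1 \<Longrightarrow> norm (f z - of_real (a (Suc n))) \<le> 1 / 2"
    by (rule entire_fast_wandering_discs) (rule that)
  then interpret fast_wandering_discs f a
    by unfold_locales
  have centre: "of_real (a 0) \<in> ball (of_real (a 0) :: complex) 1" by simp
  then obtain U where U: "U \<in> fatou_components f" "of_real (a 0) \<in> U"
    using exists_component_superset[OF disc_subset_fatou_set _ connected_ball] disc_subset_fatou_set
    by blast
  show ?thesis
  proof (intro exI conjI bexI)
    show "\<not> (\<exists>U \<in> fatou_components f. multiply_connected U)"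
      using fatou_component_simply_connected by (auto simp: multiply_connected_def)
  qed (use U transcendental fatou_component_simply_connected
        fatou_component_subset_fast_escaping_set in auto)
qed

end
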